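(* Let $n\ge 3$ be odd, and for each integer $r\ge 0$ let $H_{D_{2n}}(r)$ be the number of semi-magic squares in $MM(D_{2n})$ with line sum $r$. Then for every integer $r\ge 0$ $$H_{D_{2n}}(r)=\binom{r+2n-1}{2n-1}-\binom{r+n-1}{2n-1},$$ and the generating function is $$F_n(x)=\sum_{r\ge 0}H_{D_{2n}}(r)\,x^r=\frac{1-x^n}{(1-x)^{2n}}.$$
   Context: $D_{2n}$ is the dihedral group with $2n$ elements, realized as the subgroup of the symmetric group $S_n$ generated by the $n$-cycle $R=(1\,2\,\dots\,n)$ and the involution $C$ given by $C(i)=n+1-i$; its elements are $R^k$ and $CR^k$, $0\le k<n$. For $\sigma\in S_n$, $P_\sigma$ is the $n\times n$ permutation matrix with $[P_\sigma]_{ji}=1$ if $\sigma(i)=j$ and $0$ otherwise. $MM(D_{2n})\subseteq M(n,\mathbb{C})$ is the associative algebra over $\mathbb{C}$ generated by the matrices $P_\sigma$, $\sigma\in D_{2n}$ (equivalently, their complex linear span). A semi-magic matrix is a complex $n\times n$ matrix all of whose row sums and column sums are equal; the common value is its line sum. All elements of $MM(D_{2n})$ are semi-magic. A semi-magic square is a semi-magic matrix whose entries are non-negative integers. Binomial coefficients $\binom{a}{b}$ with $0\le a<b$ are $0$. *)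

theory Defs
  imports
    "HOL-Algebra.Sym_Groups"
    "HOL-Computational_Algebra.Formal_Power_Series"
    "Jordan_Normal_Form.Matrix"
begin

definition dihedral_rot :: "nat \<Rightarrow> nat \<Rightarrow> nat" where
  "dihedral_rot n = cycle_of_list [1..<Suc n]"

(* As usual for permutations of {1..n}, the reflection is extended by the identity
   outside {1..n}. *)
definition dihedral_refl :: "nat \<Rightarrow> nat \<Rightarrow> nat" where
  "dihedral_refl n i = (if i \<in> {1..n} then n + 1 - i else i)"

definition dihedral_perms :: "nat \<Rightarrow> (nat \<Rightarrow> nat) set" where
  "dihedral_perms n = generate (sym_group n) {dihedral_rot n, dihedral_refl n}"

(* Matrix indices start at 0 while permutations act on {1..n}, hence the shift by 1:
   the entry in row j and column i is 1 iff the permutation maps i to j. *)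
definition permutation_matrix :: "nat \<Rightarrow> (nat \<Rightarrow> nat) \<Rightarrow> complex mat" where
  "permutation_matrix n \<sigma> = mat n n (\<lambda>(j, i). if \<sigma> (Suc i) = Suc j then 1 else 0)"

(* The smallest linear subspace of the n x n matrices that contains S and is closed
   under multiplication. *)
inductive_set matrix_algebra_generated :: "nat \<Rightarrow> complex mat set \<Rightarrow> complex mat set"
  for n :: nat and S :: "complex mat set" where
  base: "A \<in> S \<Longrightarrow> A \<in> matrix_algebra_generated n S"
| zero: "0\<^sub>m n n \<in> matrix_algebra_generated n S"
| add: "A \<in> matrix_algebra_generated n S \<Longrightarrow> B \<in> matrix_algebra_generated n S
    \<Longrightarrow> A + B \<in> matrix_algebra_generated n S"
| smult: "A \<in> matrix_algebra_generated n S \<Longrightarrow> c \<cdot>\<^sub>m A \<in> matrix_algebra_generated n S"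
| mult: "A \<in> matrix_algebra_generated n S \<Longrightarrow> B \<in> matrix_algebra_generated n S
    \<Longrightarrow> A * B \<in> matrix_algebra_generated n S"

definition MM :: "nat \<Rightarrow> (nat \<Rightarrow> nat) set \<Rightarrow> complex mat set" where
  "MM n G = matrix_algebra_generated n (permutation_matrix n ` G)"

definition semi_magic :: "nat \<Rightarrow> complex mat \<Rightarrow> complex \<Rightarrow> bool" where
  "semi_magic n A s \<longleftrightarrow> A \<in> carrier_mat n n \<and>
     (\<forall>i<n. (\<Sum>j<n. A $$ (i, j)) = s) \<and> (\<forall>j<n. (\<Sum>i<n. A $$ (i, j)) = s)"

definition semi_magic_square :: "nat \<Rightarrow> complex mat \<Rightarrow> complex \<Rightarrow> bool" where
  "semi_magic_square n A s \<longleftrightarrow> semi_magic n A s \<and> (\<forall>i<n. \<forall>j<n. A $$ (i, j) \<in> \<nat>)"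

definition H_dihedral :: "nat \<Rightarrow> nat \<Rightarrow> nat" where
  "H_dihedral n r =
     card {A \<in> MM n (dihedral_perms n). semi_magic_square n A (of_nat r)}"

end

theory Submission
  imports Defs
begin

text \<open>
  Number rows and columns by \<open>0, \<dots>, n - 1\<close>. Rotations act on indices as
  \<open>i \<mapsto> i + c\<close> and reflections as \<open>i \<mapsto> c - i\<close> modulo \<open>n\<close>, so a permutation matrix of the
  dihedral group is supported on a set \<open>j - i = c\<close> or \<open>j + i = c\<close>. Hence the algebra consists
  exactly of the matrices with \<open>(j, i)\<close> entry \<open>a (j - i) + b (j + i)\<close> for arbitrary weights
  \<open>a\<close>, \<open>b\<close> on the integers modulo \<open>n\<close> (\<open>MM_dihedral\<close>), and the line sum of such a matrix is the total
  weight.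

  For odd \<open>n\<close> the number 2 is invertible modulo \<open>n\<close>, so \<open>(j, i) \<mapsto> (j - i, j + i)\<close> is a bijection and
  the entries are all the sums \<open>a u + b v\<close> with \<open>u\<close> and \<open>v\<close> independent. The only freedom in
  choosing the weights is then to move a constant from \<open>a\<close> to \<open>b\<close>. If all the entries are
  natural numbers, there is exactly one choice of weights that are natural numbers with
  \<open>min a = 0\<close>: subtract the least value from \<open>a\<close> and add it to \<open>b\<close>
  (\<open>inj_on_square_of_list\<close> and \<open>square_of_list_image\<close>).

  So semi-magic squares of line sum \<open>r\<close> correspond to the \<open>2 n\<close>-tuples of natural numbers with sum
  \<open>r\<close> whose first \<open>n\<close> members are not all positive. Stars and bars counts all tuples; lowering
  the first \<open>n\<close> members by one shows that the tuples to be excluded are as many as the tuples of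
  sum \<open>r - n\<close>. The generating function follows from the negative binomial series.
\<close>

section \<open>Affine reindexing modulo n\<close>

lemma mod_affine_inverse:
  fixes e c n :: int
  assumes "e \<in> {1, -1}"
  shows "(e * ((e * x + c) mod n) + - (e * c)) mod n = x mod n"
proof -
  have "e * (e * x + c) + - (e * c) = (e * e) * x"
    by (simp add: algebra_simps)
  also have "\<dots> = x"
    using assms by auto
  finally show ?thesis
    by (metis mod_add_left_eq mod_mult_right_eq)
qed

text \<open>
  Every reindexing of sums below is of this kind: in products of matrices the summation index is
  shifted, and in line sums it runs through \<open>j - i\<close> or \<open>j + i\<close> with \<open>i\<close> or \<open>j\<close> fixed.
\<close>
lemma sum_affine_mod:
  fixes f :: "int \<Rightarrow> 'a::comm_monoid_add"
  assumes "n > 0" and e: "e \<in> {1, -1}"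
  shows "(\<Sum>k<n. f ((e * int k + c) mod int n)) = (\<Sum>k<n. f (int k))"
proof (rule sum.reindex_bij_witness[where
      i = "\<lambda>k. nat ((e * int k + - (e * c)) mod int n)" and j = "\<lambda>k. nat ((e * int k + c) mod int n)"])
  fix k assume k: "k \<in> {..<n}"
  show "nat ((e * int (nat ((e * int k + c) mod int n)) + - (e * c)) mod int n) = k"
    using mod_affine_inverse[OF e, of "int k" c "int n"] \<open>n > 0\<close> k by simp
  have "(e * ((e * int k + - (e * c)) mod int n) + c) mod int n = int k mod int n"
    using mod_affine_inverse[OF e, of "int k" "- (e * c)" "int n"] e by auto
  then show "nat ((e * int (nat ((e * int k + - (e * c)) mod int n)) + c) mod int n) = k"
    using \<open>n > 0\<close> k by simp
qed (use \<open>n > 0\<close> in \<open>auto simp: nat_less_iff\<close>)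

corollary sum_affine_periodic:
  fixes g :: "int \<Rightarrow> 'a::comm_monoid_add"
  assumes "n > 0" and "e \<in> {1, -1}" and "\<And>x. g (x mod int n) = g x"
  shows "(\<Sum>k<n. g (e * int k + c)) = (\<Sum>k<n. g (int k))"
  using sum_affine_mod[OF assms(1,2), of g c] by (simp add: assms(3))

section \<open>The dihedral group as affine maps modulo n\<close>

text \<open>
  The sign \<open>e\<close> distinguishes rotations (\<open>e = 1\<close>) from reflections (\<open>e = -1\<close>). Points are shifted by
  one because the permutations act on \<open>{1..n}\<close>, while congruences and matrices start at 0.
\<close>
definition acts_affinely :: "nat \<Rightarrow> int \<Rightarrow> int \<Rightarrow> (nat \<Rightarrow> nat) \<Rightarrow> bool" where
  "acts_affinely n e c \<sigma> \<longleftrightarrow> (\<forall>i<n. \<sigma> (Suc i) = Suc (nat ((e * int i + c) mod int n)))"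

lemma acts_affinely_id: "acts_affinely n 1 0 id"
  by (auto simp: acts_affinely_def)

lemma acts_affinely_comp:
  assumes "acts_affinely n e c \<sigma>" and "acts_affinely n e' c' \<tau>"
  shows "acts_affinely n (e * e') (e * c' + c) (\<sigma> \<circ> \<tau>)"
  unfolding acts_affinely_def
proof (intro allI impI)
  fix i assume i: "i < n"
  then have "nat ((e' * int i + c') mod int n) < n"
    by (simp add: nat_less_iff)
  then have "(\<sigma> \<circ> \<tau>) (Suc i) = Suc (nat ((e * ((e' * int i + c') mod int n) + c) mod int n))"
    using assms i by (simp add: acts_affinely_def)
  also have "(e * ((e' * int i + c') mod int n) + c) mod int n = (e * (e' * int i + c') + c) mod int n"
    by (metis mod_add_left_eq mod_mult_right_eq)
  also have "e * (e' * int i + c') + c = e * e' * int i + (e * c' + c)"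
    by (simp add: algebra_simps)
  finally show "(\<sigma> \<circ> \<tau>) (Suc i) = Suc (nat ((e * e' * int i + (e * c' + c)) mod int n))" .
qed

lemma acts_affinely_inv:
  assumes e: "e \<in> {1, -1}" and \<sigma>: "acts_affinely n e c \<sigma>" and "\<sigma> permutes {1..n}"
  shows "acts_affinely n e (- (e * c)) (inv' \<sigma>)"
  unfolding acts_affinely_def
proof (intro allI impI)
  fix j assume j: "j < n"
  define i where "i = nat ((e * int j + - (e * c)) mod int n)"
  have i: "i < n"
    using j by (simp add: i_def nat_less_iff)
  have "(e * ((e * int j + - (e * c)) mod int n) + c) mod int n = int j mod int n"
    using mod_affine_inverse[OF e, of "int j" "- (e * c)" "int n"] e by auto
  then have "\<sigma> (Suc i) = Suc j"
    using \<sigma> i j by (simp add: acts_affinely_def i_def)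
  then show "inv' \<sigma> (Suc j) = Suc (nat ((e * int j + - (e * c)) mod int n))"
    using permutes_inverses(2)[OF assms(3)] by (metis i_def)
qed

lemma dihedral_rot_permutes: "dihedral_rot n permutes {1..n}"
  using cycle_permutes[of "[1..<Suc n]"]
  by (simp add: dihedral_rot_def atLeastLessThanSuc_atLeastAtMost del: upt_Suc)

lemma dihedral_refl_permutes: "dihedral_refl n permutes {1..n}"
  by (rule bij_imp_permutes, rule bij_betwI[where g = "dihedral_refl n"])
     (auto simp: dihedral_refl_def)

lemma acts_affinely_rot: "acts_affinely n 1 1 (dihedral_rot n)"
  unfolding acts_affinely_def
proof (intro allI impI)
  fix i assume i: "i < n"
  let ?cs = "[1..<Suc n]"
  have "map (dihedral_rot n) ?cs = rotate1 ?cs"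
    using cyclic_rotation[of ?cs 1] by (simp add: dihedral_rot_def del: upt_Suc)
  then have "map (dihedral_rot n) ?cs ! i = rotate1 ?cs ! i"
    by simp
  then have "dihedral_rot n (Suc i) = Suc (Suc i mod n)"
    using i by (simp add: nth_rotate1 del: upt_Suc)
  also have "Suc i mod n = nat ((1 * int i + 1) mod int n)"
    by (metis add.commute mult_1 nat_int of_nat_Suc of_nat_mod)
  finally show "dihedral_rot n (Suc i) = Suc (nat ((1 * int i + 1) mod int n))" .
qed

lemma acts_affinely_refl: "acts_affinely n (-1) (-1) (dihedral_refl n)"
  unfolding acts_affinely_def
proof (intro allI impI)
  fix i assume i: "i < n"
  have "(- 1 * int i + - 1) mod int n = (int n - 1 - int i) mod int n"
    by (metis (no_types, opaque_lifting) add.commute diff_diff_eq2 minus_diff_eq mod_add_self1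
        mult_minus1 uminus_add_conv_diff diff_conv_add_uminus)
  also have "\<dots> = int n - 1 - int i"
    using i by simp
  finally show "dihedral_refl n (Suc i) = Suc (nat ((- 1 * int i + - 1) mod int n))"
    using i by (auto simp: dihedral_refl_def)
qed

lemma dihedral_perms_act_affinely:
  assumes "\<sigma> \<in> dihedral_perms n"
  shows "\<exists>e \<in> {1, -1}. \<exists>c. acts_affinely n e c \<sigma>"
  using assms unfolding dihedral_perms_def
proof (induction rule: generate.induct)
  case one
  then show ?case
    unfolding sym_group_one using acts_affinely_id by blast
next
  case (incl h)
  then show ?case
    using acts_affinely_rot acts_affinely_refl by blast
next
  case (inv h)
  then have perm: "h permutes {1..n}"
    using dihedral_rot_permutes dihedral_refl_permutes by blast
  moreover obtain e c where "e \<in> {1, -1}" "acts_affinely n e c h"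
    using inv acts_affinely_rot acts_affinely_refl by blast
  ultimately have "acts_affinely n e (- (e * c)) (inv' h)"
    using acts_affinely_inv by blast
  then show ?case
    using \<open>e \<in> {1, -1}\<close> perm by (auto simp: sym_group_carrier)
next
  case (eng h1 h2)
  then obtain e c e' c' where "e \<in> {1, -1}" "e' \<in> {1, -1}"
      and "acts_affinely n e c h1" "acts_affinely n e' c' h2"
    by blast
  then have "acts_affinely n (e * e') (e * c' + c) (h1 \<circ> h2)" "e * e' \<in> {1, -1}"
    using acts_affinely_comp by auto
  then show ?case
    unfolding sym_group_mult by blast
qed

lemma acts_affinely_cong_mod:
  "c mod int n = c' mod int n \<Longrightarrow> acts_affinely n e c \<sigma> \<longleftrightarrow> acts_affinely n e c' \<sigma>"
  unfolding acts_affinely_def by (metis mod_add_right_eq)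

text \<open>
  Powers of the rotation realise all maps \<open>i \<mapsto> i + d\<close>. In shifted indices the generating
  reflection is \<open>i \<mapsto> -1 - i\<close>, and composing it with the rotation by \<open>-1 - c\<close> yields \<open>i \<mapsto> c - i\<close>.
\<close>
lemma affine_map_in_dihedral_perms:
  assumes "n > 0" and e: "e \<in> {1, -1}"
  shows "\<exists>\<sigma> \<in> dihedral_perms n. acts_affinely n e c \<sigma>"
proof -
  have rotations: "\<exists>\<sigma> \<in> dihedral_perms n. acts_affinely n 1 (int k) \<sigma>" for k
  proof (induction k)
    case 0
    show ?case
      using generate.one[of "sym_group n"] acts_affinely_id
      by (auto simp: dihedral_perms_def sym_group_one)
  next
    case (Suc k)
    then obtain \<sigma> where \<sigma>: "\<sigma> \<in> dihedral_perms n" "acts_affinely n 1 (int k) \<sigma>"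
      by blast
    have "dihedral_rot n \<circ> \<sigma> \<in> dihedral_perms n"
      using generate.eng[OF generate.incl \<sigma>(1)[unfolded dihedral_perms_def], of "dihedral_rot n"]
      by (simp add: dihedral_perms_def sym_group_mult)
    moreover have "acts_affinely n 1 (int (Suc k)) (dihedral_rot n \<circ> \<sigma>)"
      using acts_affinely_comp[OF acts_affinely_rot \<sigma>(2)] by (simp add: add.commute)
    ultimately show ?case
      by blast
  qed
  have rotation: "\<exists>\<sigma> \<in> dihedral_perms n. acts_affinely n 1 d \<sigma>" for d
    using rotations[of "nat (d mod int n)"] acts_affinely_cong_mod[of "d mod int n" n d] \<open>n > 0\<close>
    by simp
  show ?thesis
  proof (cases "e = 1")
    case True
    then show ?thesis
      using rotation by simp
  next
    case False
    obtain \<sigma> where \<sigma>: "\<sigma> \<in> dihedral_perms n" "acts_affinely n 1 (- 1 - c) \<sigma>"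
      using rotation by blast
    have "dihedral_refl n \<circ> \<sigma> \<in> dihedral_perms n"
      using generate.eng[OF generate.incl \<sigma>(1)[unfolded dihedral_perms_def], of "dihedral_refl n"]
      by (simp add: dihedral_perms_def sym_group_mult)
    moreover have "acts_affinely n e c (dihedral_refl n \<circ> \<sigma>)"
      using acts_affinely_comp[OF acts_affinely_refl \<sigma>(2)] False e by simp
    ultimately show ?thesis
      by blast
  qed
qed

section \<open>The algebra generated by the dihedral permutation matrices\<close>

text \<open>
  A general linear combination of the permutation matrices: \<open>a u\<close> is the coefficient of the
  rotation \<open>i \<mapsto> i + u\<close> and \<open>b v\<close> that of the reflection \<open>i \<mapsto> v - i\<close>. Only the values of \<open>a\<close> and \<open>b\<close>
  on \<open>{0..<n}\<close> matter.
\<close>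
definition dihedral_matrix :: "nat \<Rightarrow> (int \<Rightarrow> complex) \<Rightarrow> (int \<Rightarrow> complex) \<Rightarrow> complex mat" where
  "dihedral_matrix n a b =
     mat n n (\<lambda>(j, i). a ((int j - int i) mod int n) + b ((int j + int i) mod int n))"

lemma dihedral_matrix_carrier [simp]: "dihedral_matrix n a b \<in> carrier_mat n n"
  by (simp add: dihedral_matrix_def)

lemma dihedral_matrix_index:
  "j < n \<Longrightarrow> i < n \<Longrightarrow>
     dihedral_matrix n a b $$ (j, i) = a ((int j - int i) mod int n) + b ((int j + int i) mod int n)"
  by (simp add: dihedral_matrix_def)

lemma dihedral_matrix_add:
  "dihedral_matrix n a b + dihedral_matrix n a' b' = dihedral_matrix n (\<lambda>x. a x + a' x) (\<lambda>x. b x + b' x)"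
  by (rule eq_matI) (auto simp: dihedral_matrix_def)

lemma dihedral_matrix_smult:
  "c \<cdot>\<^sub>m dihedral_matrix n a b = dihedral_matrix n (\<lambda>x. c * a x) (\<lambda>x. c * b x)"
  by (rule eq_matI) (auto simp: dihedral_matrix_def algebra_simps)

text \<open>
  In the product, shifting the summation index \<open>k\<close> by \<open>i\<close> or \<open>-i\<close> turns the second factor into a
  function of \<open>k\<close> alone. The first factor then depends on \<open>k\<close> and \<open>j - i\<close> when both weights are of
  the same type (rotation with rotation, reflection with reflection), and on \<open>k\<close> and \<open>j + i\<close>
  otherwise. The new weights are the resulting cyclic convolutions and correlations.
\<close>
lemma dihedral_matrix_mult:
  "\<exists>p q. dihedral_matrix n a b * dihedral_matrix n a' b' = dihedral_matrix n p q"
proof (intro exI)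
  let ?m = "\<lambda>x. x mod int n"
  let ?p = "\<lambda>u. (\<Sum>k<n. a (?m (u - int k)) * a' (?m (int k)))
              + (\<Sum>k<n. b (?m (u + int k)) * b' (?m (int k)))"
  let ?q = "\<lambda>v. (\<Sum>k<n. a (?m (v - int k)) * b' (?m (int k)))
              + (\<Sum>k<n. b (?m (v + int k)) * a' (?m (int k)))"
  let ?A = "dihedral_matrix n a b" and ?B = "dihedral_matrix n a' b'"
  show "?A * ?B = dihedral_matrix n ?p ?q"
  proof (rule eq_matI)
    fix j i assume "j < dim_row (dihedral_matrix n ?p ?q)" "i < dim_col (dihedral_matrix n ?p ?q)"
    then have ji: "j < n" "i < n"
      by (simp_all add: dihedral_matrix_def)
    then have n: "n > 0"
      by simp
    have shift: "(\<Sum>k<n. g (int k)) = (\<Sum>k<n. g (int k + c))"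
      if "\<And>x. g (?m x) = g x" for g :: "int \<Rightarrow> complex" and c
      using sum_affine_periodic[OF n, of 1 g c] that by simp
    have "(?A * ?B) $$ (j, i) = (\<Sum>k<n. ?A $$ (j, k) * ?B $$ (k, i))"
      using ji by (simp add: dihedral_matrix_def scalar_prod_def atLeast0LessThan)
    also have "\<dots> = (\<Sum>k<n. a (?m (int j - int k)) * a' (?m (int k - int i)))
                 + (\<Sum>k<n. b (?m (int j + int k)) * b' (?m (int k + int i)))
                 + (\<Sum>k<n. a (?m (int j - int k)) * b' (?m (int k + int i)))
                 + (\<Sum>k<n. b (?m (int j + int k)) * a' (?m (int k - int i)))"
      using ji by (simp add: dihedral_matrix_index algebra_simps sum.distrib)
    also have "(\<Sum>k<n. a (?m (int j - int k)) * a' (?m (int k - int i)))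
        = (\<Sum>k<n. a (?m (int j - int i - int k)) * a' (?m (int k)))"
      by (subst shift[where c = "int i"]) (simp_all add: mod_simps algebra_simps)
    also have "(\<Sum>k<n. b (?m (int j + int k)) * b' (?m (int k + int i)))
        = (\<Sum>k<n. b (?m (int j - int i + int k)) * b' (?m (int k)))"
      by (subst shift[where c = "- int i"]) (simp_all add: mod_simps algebra_simps)
    also have "(\<Sum>k<n. a (?m (int j - int k)) * b' (?m (int k + int i)))
        = (\<Sum>k<n. a (?m (int j + int i - int k)) * b' (?m (int k)))"
      by (subst shift[where c = "- int i"]) (simp_all add: mod_simps algebra_simps)
    also have "(\<Sum>k<n. b (?m (int j + int k)) * a' (?m (int k - int i)))
        = (\<Sum>k<n. b (?m (int j + int i + int k)) * a' (?m (int k)))"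
      by (subst shift[where c = "int i"]) (simp_all add: mod_simps algebra_simps)
    finally show "(?A * ?B) $$ (j, i) = dihedral_matrix n ?p ?q $$ (j, i)"
      using ji by (simp add: dihedral_matrix_index mod_simps add.assoc)
  qed (auto simp: dihedral_matrix_def)
qed

lemma permutation_matrix_index:
  assumes "acts_affinely n e c \<sigma>" and "j < n" and "i < n"
  shows "permutation_matrix n \<sigma> $$ (j, i) =
    (if (int j - e * int i) mod int n = c mod int n then 1 else 0)"
proof -
  have "\<sigma> (Suc i) = Suc j \<longleftrightarrow> (e * int i + c) mod int n = int j mod int n"
    using assms by (auto simp: acts_affinely_def nat_eq_iff2)
  also have "\<dots> \<longleftrightarrow> (int j - e * int i) mod int n = c mod int n"
    unfolding mod_eq_dvd_iff by (metis add.commute diff_diff_eq2 dvd_diff_commute diff_diff_eq)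
  finally show ?thesis
    using assms by (simp add: permutation_matrix_def)
qed

lemma permutation_matrix_rotation:
  assumes "acts_affinely n 1 c \<sigma>"
  shows "permutation_matrix n \<sigma> = dihedral_matrix n (\<lambda>x. if x = c mod int n then 1 else 0) (\<lambda>_. 0)"
  using permutation_matrix_index[OF assms]
  by (intro eq_matI) (auto simp: dihedral_matrix_def permutation_matrix_def)

lemma permutation_matrix_reflection:
  assumes "acts_affinely n (-1) c \<sigma>"
  shows "permutation_matrix n \<sigma> = dihedral_matrix n (\<lambda>_. 0) (\<lambda>x. if x = c mod int n then 1 else 0)"
  using permutation_matrix_index[OF assms]
  by (intro eq_matI) (auto simp: dihedral_matrix_def permutation_matrix_def)

text \<open>
  One inclusion holds because the matrices of this form are an algebra containing the generators.
  For the other, a dihedral matrix is assembled from the permutation matrices by switching on the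
  weights at \<open>0, 1, \<dots>, n - 1\<close> one after the other.
\<close>
lemma MM_dihedral:
  assumes "n > 0"
  shows "MM n (dihedral_perms n) = {dihedral_matrix n a b | a b. True}"
proof (intro equalityI subsetI)
  fix A assume "A \<in> MM n (dihedral_perms n)"
  then have "\<exists>a b. A = dihedral_matrix n a b"
    unfolding MM_def
  proof (induction rule: matrix_algebra_generated.induct)
    case (base A)
    then obtain \<sigma> e c where "A = permutation_matrix n \<sigma>" "e \<in> {1, -1}" "acts_affinely n e c \<sigma>"
      using dihedral_perms_act_affinely by blast
    then show ?case
      using permutation_matrix_rotation permutation_matrix_reflection by blast
  next
    case zero
    have "0\<^sub>m n n = dihedral_matrix n (\<lambda>_. 0) (\<lambda>_. 0)"
      by (rule eq_matI) (auto simp: dihedral_matrix_def)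
    then show ?case
      by blast
  next
    case (mult A B)
    then show ?case
      using dihedral_matrix_mult by blast
  qed (use dihedral_matrix_add dihedral_matrix_smult in blast)+
  then show "A \<in> {dihedral_matrix n a b | a b. True}"
    by blast
next
  fix A assume "A \<in> {dihedral_matrix n a b | a b. True}"
  then obtain a b where A: "A = dihedral_matrix n a b"
    by blast
  let ?\<delta> = "\<lambda>c x. if x = int c then 1 else (0::complex)"
  have elementary: "dihedral_matrix n (?\<delta> c) (\<lambda>_. 0) \<in> MM n (dihedral_perms n)"
      "dihedral_matrix n (\<lambda>_. 0) (?\<delta> c) \<in> MM n (dihedral_perms n)" if "c < n" for c
  proof -
    obtain \<sigma> \<tau> where "\<sigma> \<in> dihedral_perms n" "acts_affinely n 1 (int c) \<sigma>"
        and "\<tau> \<in> dihedral_perms n" "acts_affinely n (-1) (int c) \<tau>"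
      using affine_map_in_dihedral_perms[OF assms] by blast
    moreover from this have "dihedral_matrix n (?\<delta> c) (\<lambda>_. 0) = permutation_matrix n \<sigma>"
        "dihedral_matrix n (\<lambda>_. 0) (?\<delta> c) = permutation_matrix n \<tau>"
      using permutation_matrix_rotation[of n "int c" \<sigma>]
        permutation_matrix_reflection[of n "int c" \<tau>] that by simp_all
    ultimately show "dihedral_matrix n (?\<delta> c) (\<lambda>_. 0) \<in> MM n (dihedral_perms n)"
        "dihedral_matrix n (\<lambda>_. 0) (?\<delta> c) \<in> MM n (dihedral_perms n)"
      unfolding MM_def using matrix_algebra_generated.base by auto
  qed
  (* Truncation of a weight function to the residues below m. *)
  let ?t = "\<lambda>m (f :: int \<Rightarrow> complex) x. if x < int m then f x else 0"
  have "dihedral_matrix n (?t m a) (?t m b) \<in> MM n (dihedral_perms n)" if "m \<le> n" for m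
    using that
  proof (induction m)
    case 0
    have "\<not> x mod int n < 0" for x
      using assms by (simp add: not_less)
    then have "dihedral_matrix n (?t 0 a) (?t 0 b) = 0\<^sub>m n n"
      by (intro eq_matI) (simp_all add: dihedral_matrix_def)
    then show ?case
      by (simp add: MM_def matrix_algebra_generated.zero)
  next
    case (Suc m)
    have step: "?t (Suc m) f = (\<lambda>x. ?t m f x + f (int m) * ?\<delta> m x)" for f :: "int \<Rightarrow> complex"
    proof
      fix x
      show "?t (Suc m) f x = ?t m f x + f (int m) * ?\<delta> m x"
        by (cases "x = int m") auto
    qed
    have "dihedral_matrix n (?t (Suc m) a) (?t (Suc m) b) = dihedral_matrix n (?t m a) (?t m b)
        + (a (int m) \<cdot>\<^sub>m dihedral_matrix n (?\<delta> m) (\<lambda>_. 0) + b (int m) \<cdot>\<^sub>m dihedral_matrix n (\<lambda>_. 0) (?\<delta> m))"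
      unfolding step by (simp add: dihedral_matrix_add dihedral_matrix_smult)
    then show ?case
      using Suc elementary[of m] unfolding MM_def
      by (auto intro!: matrix_algebra_generated.add matrix_algebra_generated.smult)
  qed
  from this[of n] have "dihedral_matrix n (?t n a) (?t n b) \<in> MM n (dihedral_perms n)"
    by simp
  moreover have "dihedral_matrix n (?t n a) (?t n b) = A"
    using assms by (intro eq_matI) (auto simp: A dihedral_matrix_def)
  ultimately show "A \<in> MM n (dihedral_perms n)"
    by simp
qed

text \<open>
  Along a row or a column, each of \<open>j - i\<close> and \<open>j + i\<close> takes every residue once, so every line sum is
  the total weight.
\<close>
lemma semi_magic_dihedral_matrix:
  assumes "n > 0"
  shows "semi_magic n (dihedral_matrix n a b) s \<longleftrightarrow> s = (\<Sum>k<n. a (int k)) + (\<Sum>k<n. b (int k))"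
proof -
  have "(\<Sum>i<n. dihedral_matrix n a b $$ (j, i)) = (\<Sum>k<n. a (int k)) + (\<Sum>k<n. b (int k))"
    if "j < n" for j
    using that sum_affine_mod[OF assms, of "-1" a "int j"] sum_affine_mod[OF assms, of 1 b "int j"]
    by (simp add: dihedral_matrix_index sum.distrib add.commute)
  moreover have "(\<Sum>j<n. dihedral_matrix n a b $$ (j, i)) = (\<Sum>k<n. a (int k)) + (\<Sum>k<n. b (int k))"
    if "i < n" for i
    using that sum_affine_mod[OF assms, of 1 a "- int i"] sum_affine_mod[OF assms, of 1 b "int i"]
    by (simp add: dihedral_matrix_index sum.distrib)
  ultimately show ?thesis
    using assms by (auto simp: semi_magic_def)
qed

section \<open>Semi-magic squares as weights on the dihedral group\<close>

text \<open>
  This is where oddness enters: \<open>h = (n + 1) / 2\<close> is an inverse of 2 modulo \<open>n\<close>, so the system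
  \<open>j - i = u\<close>, \<open>j + i = v\<close> is solved by \<open>j = h (u + v)\<close> and \<open>i = h (v - u)\<close>.
\<close>
lemma difference_and_sum_mod_odd:
  assumes "odd n" and "u < n" and "v < n"
  obtains j i where "j < n" "i < n" "(int j - int i) mod int n = int u" "(int j + int i) mod int n = int v"
proof -
  obtain k where k: "n = 2 * k + 1"
    using \<open>odd n\<close> by (rule oddE)
  define h where "h = int k + 1"
  have h: "2 * h = int n + 1"
    by (simp add: h_def k)
  define j where "j = nat ((h * (int u + int v)) mod int n)"
  define i where "i = nat ((h * (int v - int u)) mod int n)"
  have n: "int n > 0"
    using k by simp
  have ji: "int j = (h * (int u + int v)) mod int n" "int i = (h * (int v - int u)) mod int n"
    using n by (simp_all add: j_def i_def)
  have "h * (int u + int v) - h * (int v - int u) = (2 * h) * int u"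
    by (simp add: algebra_simps)
  then have "(int j - int i) mod int n = (int u + int n * int u) mod int n"
    unfolding ji h by (simp add: mod_diff_eq algebra_simps)
  then have "(int j - int i) mod int n = int u"
    using assms by simp
  moreover have "h * (int u + int v) + h * (int v - int u) = (2 * h) * int v"
    by (simp add: algebra_simps)
  then have "(int j + int i) mod int n = (int v + int n * int v) mod int n"
    unfolding ji h by (simp add: mod_add_eq algebra_simps)
  then have "(int j + int i) mod int n = int v"
    using assms by simp
  moreover have "j < n" "i < n"
    using n by (simp_all add: j_def i_def nat_less_iff)
  ultimately show ?thesis
    using that by blast
qed

text \<open>
  The weights of rotations and reflections are stored in one list of length \<open>2 * n\<close>, rotations
  first, so that stars and bars applies directly.
\<close>
definition square_of_list :: "nat \<Rightarrow> nat list \<Rightarrow> complex mat" where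
  "square_of_list n l =
     dihedral_matrix n (\<lambda>u. of_nat (l ! nat u)) (\<lambda>v. of_nat (l ! (n + nat v)))"

text \<open>
  Since weights are natural numbers, a zero among the rotation weights says that their minimum is 0.
\<close>
definition normalised_lists :: "nat \<Rightarrow> nat \<Rightarrow> nat list set" where
  "normalised_lists n r = {l. length l = 2 * n \<and> sum_list l = r \<and> (\<exists>u<n. l ! u = 0)}"

lemma semi_magic_square_of_list:
  assumes "n > 0" and "length l = 2 * n"
  shows "semi_magic_square n (square_of_list n l) (of_nat r) \<longleftrightarrow> sum_list l = r"
proof -
  have "sum_list l = sum_list (take n l) + sum_list (drop n l)"
    by (metis append_take_drop_id sum_list_append)
  also have "\<dots> = (\<Sum>k<n. l ! k) + (\<Sum>k<n. l ! (n + k))"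
    using assms(2) by (simp add: sum_list_sum_nth atLeast0LessThan)
  finally have "(\<Sum>k<n. of_nat (l ! k)) + (\<Sum>k<n. of_nat (l ! (n + k))) = (of_nat (sum_list l) :: complex)"
    by simp
  moreover have "square_of_list n l $$ (j, i) \<in> \<nat>" if "j < n" "i < n" for j i
    using that by (simp add: square_of_list_def dihedral_matrix_index)
  ultimately show ?thesis
    unfolding semi_magic_square_def
    by (auto simp: square_of_list_def semi_magic_dihedral_matrix[OF assms(1)] of_nat_eq_iff
        simp del: of_nat_sum)
qed

lemma square_of_list_weights:
  assumes "odd n" and "square_of_list n l = square_of_list n l'" and "u < n" and "v < n"
  shows "l ! u + l ! (n + v) = l' ! u + l' ! (n + v)"
proof -
  obtain j i where ji: "j < n" "i < n" "(int j - int i) mod int n = int u" "(int j + int i) mod int n = int v"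
    using difference_and_sum_mod_odd assms(1,3,4) by blast
  have "square_of_list n l $$ (j, i) = square_of_list n l' $$ (j, i)"
    by (simp add: assms(2))
  then have "(of_nat (l ! u + l ! (n + v)) :: complex) = of_nat (l' ! u + l' ! (n + v))"
    using ji by (simp add: square_of_list_def dihedral_matrix_index)
  then show ?thesis
    by (simp only: of_nat_eq_iff)
qed

text \<open>
  At a zero of the rotation weights of one list, an entry of the square is just a reflection weight
  of that list, hence at least the reflection weight of the other list. By symmetry the
  reflection weights agree, and therefore so do the rotation weights.
\<close>
lemma inj_on_square_of_list:
  assumes "odd n"
  shows "inj_on (square_of_list n) (normalised_lists n r)"
proof (rule inj_onI)
  fix l l'
  assume l: "l \<in> normalised_lists n r" and l': "l' \<in> normalised_lists n r"
    and eq: "square_of_list n l = square_of_list n l'"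
  obtain u u' where u: "u < n" "l ! u = 0" and u': "u' < n" "l' ! u' = 0"
    using l l' by (auto simp: normalised_lists_def)
  have second: "l ! (n + v) = l' ! (n + v)" if "v < n" for v
    using square_of_list_weights[OF assms eq u(1) that] square_of_list_weights[OF assms eq u'(1) that] u u'
    by simp
  then have first: "l ! v = l' ! v" if "v < n" for v
    using square_of_list_weights[OF assms eq that that] that by simp
  show "l = l'"
  proof (rule nth_equalityI)
    fix k assume "k < length l"
    then have "k < n \<or> (\<exists>v<n. k = n + v)"
      using l by (auto simp: normalised_lists_def) presburger
    then show "l ! k = l' ! k"
      using first second by blast
  qed (use l l' in \<open>simp add: normalised_lists_def\<close>)
qed

text \<open>
  Given a square with complex weights \<open>a\<close> and \<open>b\<close>, let \<open>N u v\<close> be the natural number \<open>a u + b v\<close> and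
  let \<open>a\<close> be least at \<open>w\<close>, in the sense that \<open>N w 0\<close> is the least \<open>N u 0\<close>. The normalised weights
  \<open>a u - a w\<close> and \<open>b v + a w\<close> are then the natural numbers \<open>N u 0 - N w 0\<close> and \<open>N w v\<close>.
\<close>
lemma square_of_list_image:
  assumes "odd n"
  shows "square_of_list n ` normalised_lists n r
       = {A \<in> MM n (dihedral_perms n). semi_magic_square n A (of_nat r)}"
proof (intro equalityI subsetI)
  have "n > 0"
    using assms by (simp add: odd_pos)
  fix A assume "A \<in> square_of_list n ` normalised_lists n r"
  then show "A \<in> {A \<in> MM n (dihedral_perms n). semi_magic_square n A (of_nat r)}"
    using semi_magic_square_of_list[OF \<open>n > 0\<close>]
    by (auto simp: normalised_lists_def MM_dihedral[OF \<open>n > 0\<close>]) (auto simp: square_of_list_def)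
next
  have "n > 0"
    using assms by (simp add: odd_pos)
  fix A assume "A \<in> {A \<in> MM n (dihedral_perms n). semi_magic_square n A (of_nat r)}"
  then obtain a b where A: "A = dihedral_matrix n a b" and magic: "semi_magic_square n A (of_nat r)"
    by (auto simp: MM_dihedral[OF \<open>n > 0\<close>])
  have "\<exists>m. a (int u) + b (int v) = of_nat m" if uv: "u < n" "v < n" for u v
  proof -
    obtain j i where ji: "j < n" "i < n" "(int j - int i) mod int n = int u" "(int j + int i) mod int n = int v"
      using difference_and_sum_mod_odd[OF assms uv] by blast
    then have "a (int u) + b (int v) = A $$ (j, i)"
      by (simp add: A dihedral_matrix_index)
    also have "\<dots> \<in> \<nat>"
      using magic ji by (simp add: semi_magic_square_def)
    finally show ?thesis
      by (auto elim: Nats_cases)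
  qed
  then obtain N where N: "a (int u) + b (int v) = of_nat (N u v)" if "u < n" "v < n" for u v
    by metis
  obtain w where w: "w < n" "\<And>u. u < n \<Longrightarrow> N w 0 \<le> N u 0"
    using arg_min_if_finite[of "{..<n}" "\<lambda>u. N u 0"] \<open>n > 0\<close>
    by (metis finite_lessThan lessThan_empty_iff lessThan_iff linorder_not_le not_gr_zero)
  (* As a sum of a function of u and one of v, N satisfies
     N u v + N w 0 = N u 0 + N w v; the subtraction
     below does not truncate because of the choice of w. *)
  have exchange: "N u v = (N u 0 - N w 0) + N w v" if "u < n" "v < n" for u v
  proof -
    have "(of_nat (N u v + N w 0) :: complex) = of_nat (N u 0 + N w v)"
      unfolding of_nat_add N[OF that, symmetric] N[OF that(1) \<open>n > 0\<close>, symmetric]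
        N[OF w(1) that(2), symmetric] N[OF w(1) \<open>n > 0\<close>, symmetric]
      by (simp add: algebra_simps)
    then have "N u v + N w 0 = N u 0 + N w v"
      by (simp only: of_nat_eq_iff)
    then show ?thesis
      using w(2)[OF that(1)] by simp
  qed
  define l where "l = map (\<lambda>u. N u 0 - N w 0) [0..<n] @ map (N w) [0..<n]"
  have "length l = 2 * n" "l ! w = 0"
    using w(1) by (simp_all add: l_def nth_append)
  moreover have "square_of_list n l = A"
  proof (rule eq_matI)
    fix j i assume "j < dim_row A" "i < dim_col A"
    then have ji: "j < n" "i < n"
      by (simp_all add: A dihedral_matrix_def)
    define u v where "u = nat ((int j - int i) mod int n)" and "v = nat ((int j + int i) mod int n)"
    have uv: "u < n" "v < n" "(int j - int i) mod int n = int u" "(int j + int i) mod int n = int v"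
      using \<open>n > 0\<close> by (simp_all add: u_def v_def nat_less_iff)
    have "square_of_list n l $$ (j, i) = of_nat (l ! u + l ! (n + v))"
      using ji uv by (simp add: square_of_list_def dihedral_matrix_index)
    also have "l ! u + l ! (n + v) = N u v"
      using uv exchange[of u v] by (simp add: l_def nth_append)
    also have "of_nat (N u v) = A $$ (j, i)"
      using ji uv N[of u v] by (simp add: A dihedral_matrix_index)
    finally show "square_of_list n l $$ (j, i) = A $$ (j, i)" .
  qed (simp_all add: A square_of_list_def dihedral_matrix_def)
  moreover from calculation magic have "sum_list l = r"
    using semi_magic_square_of_list[OF \<open>n > 0\<close>] by blast
  ultimately show "A \<in> square_of_list n ` normalised_lists n r"
    using w(1) by (auto simp: normalised_lists_def)
qed

section \<open>Counting\<close>

lemma finite_lists_length_sum: "finite {l :: nat list. length l = m \<and> sum_list l = r}"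
proof (rule finite_subset)
  show "{l. length l = m \<and> sum_list l = r} \<subseteq> {l. set l \<subseteq> {..r} \<and> length l = m}"
    using member_le_sum_list by fastforce
qed (simp add: finite_lists_length_eq)

text \<open>
  Lowering the first \<open>n\<close> members by one is a bijection onto the lists of sum \<open>r - n\<close>. For \<open>r < n\<close> there
  are no such lists, in agreement with the binomial coefficient, whose upper argument is then
  smaller than its lower one.
\<close>
lemma card_positive_headed_lists:
  assumes "n > 0"
  shows "card {l :: nat list. length l = 2 * n \<and> sum_list l = r \<and> (\<forall>u<n. l ! u > 0)}
       = (r + n - 1) choose (2 * n - 1)"
    (is "card ?P = _")
proof -
  have split: "sum_list l = sum_list (take n l) + sum_list (drop n l)" for l :: "nat list"
    by (metis append_take_drop_id sum_list_append)
  have lower: "sum_list (map (\<lambda>x. x - 1) (take n l)) + n = sum_list (take n l)" if "l \<in> ?P" for l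
  proof -
    have "map (\<lambda>x. Suc (x - 1)) (take n l) = take n l"
      using that by (intro nth_equalityI) auto
    moreover have "length (take n l) = n"
      using that by simp
    ultimately show ?thesis
      using sum_list_Suc[of "\<lambda>x. x - 1" "take n l"] by simp
  qed
  show ?thesis
  proof (cases "n \<le> r")
    case False
    have "?P = {}"
    proof (rule ccontr)
      assume "?P \<noteq> {}"
      then obtain l where "l \<in> ?P"
        by blast
      then show False
        using lower[of l] split[of l] False by simp
    qed
    then show ?thesis
      using False by (simp only: card.empty) (simp add: binomial_eq_0)
  next
    case True
    let ?Q = "{l :: nat list. length l = 2 * n \<and> sum_list l = r - n}"
    have "bij_betw (\<lambda>l. map Suc (take n l) @ drop n l) ?Q ?P"
    proof (rule bij_betw_byWitness[where f' = "\<lambda>l. map (\<lambda>x. x - 1) (take n l) @ drop n l"])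
      show "\<forall>l\<in>?P. map Suc (take n (map (\<lambda>x. x - 1) (take n l) @ drop n l))
              @ drop n (map (\<lambda>x. x - 1) (take n l) @ drop n l) = l"
        by (auto intro!: nth_equalityI simp: nth_append)
      show "(\<lambda>l. map Suc (take n l) @ drop n l) ` ?Q \<subseteq> ?P"
      proof (intro image_subsetI)
        fix l assume "l \<in> ?Q"
        then have l: "length l = 2 * n" "sum_list l = r - n"
          by simp_all
        then have "sum_list (map Suc (take n l) @ drop n l) = sum_list l + n"
          using split[of l] sum_list_Suc[of "\<lambda>x. x" "take n l"] by simp
        then show "map Suc (take n l) @ drop n l \<in> ?P"
          using l True by (simp add: nth_append)
      qed
      show "(\<lambda>l. map (\<lambda>x. x - 1) (take n l) @ drop n l) ` ?P \<subseteq> ?Q"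
      proof (intro image_subsetI)
        fix l assume l: "l \<in> ?P"
        have "sum_list (map (\<lambda>x. x - 1) (take n l) @ drop n l) = sum_list l - n"
          unfolding sum_list_append using lower[OF l] split[of l] by linarith
        then show "map (\<lambda>x. x - 1) (take n l) @ drop n l \<in> ?Q"
          using l by simp
      qed
    qed (auto simp: comp_def)
    then have "card ?P = card ?Q"
      by (simp add: bij_betw_same_card)
    also have "\<dots> = (r + n - 1) choose (r - n)"
      using True by (simp add: card_length_sum_list mult_2)
    also have "\<dots> = (r + n - 1) choose (2 * n - 1)"
      using True assms by (subst binomial_symmetric) (simp_all add: mult_2)
    finally show ?thesis .
  qed
qed

lemma card_normalised_lists:
  assumes "n > 0"
  shows "int (card (normalised_lists n r)) =
           int ((r + 2 * n - 1) choose (2 * n - 1)) - int ((r + n - 1) choose (2 * n - 1))"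
proof -
  let ?A = "{l :: nat list. length l = 2 * n \<and> sum_list l = r}"
  let ?P = "{l :: nat list. length l = 2 * n \<and> sum_list l = r \<and> (\<forall>u<n. l ! u > 0)}"
  have "normalised_lists n r = ?A - ?P"
    by (auto simp: normalised_lists_def)
  moreover have "int (card (?A - ?P)) = int (card ?A) - int (card ?P)"
  proof -
    have "?P \<subseteq> ?A" "finite ?A"
      using finite_lists_length_sum by auto
    then show ?thesis
      by (simp only: card_Diff_subset finite_subset card_mono of_nat_diff)
  qed
  moreover have "card ?A = (r + 2 * n - 1) choose (2 * n - 1)"
    using assms by (simp add: card_length_sum_list) (subst binomial_symmetric, simp_all)
  ultimately show ?thesis
    by (simp only: card_positive_headed_lists[OF assms])
qed

lemma inverse_one_minus_fps_X_power:
  assumes "m > 0"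
  shows "inverse ((1 - fps_X :: 'a::field_char_0 fps) ^ m)
       = Abs_fps (\<lambda>r. of_nat ((r + m - 1) choose (m - 1)))"
proof -
  have "(m + r - 1) choose r = (r + m - 1) choose (m - 1)" for r
    using assms by (subst binomial_symmetric) (simp_all add: add.commute)
  then show ?thesis
    using one_minus_const_fps_X_neg_power'[OF assms, of "1::'a"] by simp
qed

theorem theorem1:
  fixes n :: nat
  assumes "n \<ge> 3" and "odd n"
  shows "(\<forall>r. int (H_dihedral n r) =
           int ((r + 2 * n - 1) choose (2 * n - 1)) - int ((r + n - 1) choose (2 * n - 1)))
       \<and> Abs_fps (\<lambda>r. of_nat (H_dihedral n r) :: rat)
         = (1 - fps_X ^ n) / (1 - fps_X) ^ (2 * n)"
proof (intro conjI allI)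
  have "n > 0"
    using assms(1) by simp
  show count: "int (H_dihedral n r) =
      int ((r + 2 * n - 1) choose (2 * n - 1)) - int ((r + n - 1) choose (2 * n - 1))" for r
    using card_normalised_lists[OF \<open>n > 0\<close>, of r] card_image[OF inj_on_square_of_list[OF assms(2)], of r]
      square_of_list_image[OF assms(2), of r] by (simp add: H_dihedral_def)
  let ?f = "Abs_fps (\<lambda>r. of_nat ((r + 2 * n - 1) choose (2 * n - 1)) :: rat)"
  have inverse_power: "inverse ((1 - fps_X) ^ (2 * n)) = ?f"
    using inverse_one_minus_fps_X_power[of "2 * n"] \<open>n > 0\<close> by simp
  have "(1 - fps_X ^ n) / (1 - fps_X) ^ (2 * n) = (1 - fps_X ^ n) * ?f"
    using inverse_power by (subst fps_divide_unit) (simp_all add: fps_nth_power_0)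
  also have "\<dots> = Abs_fps (\<lambda>r. of_nat (H_dihedral n r))"
  proof (rule fps_ext)
    fix r
    have "of_int (int (H_dihedral n r)) = (of_int (int ((r + 2 * n - 1) choose (2 * n - 1)))
        - of_int (int ((r + n - 1) choose (2 * n - 1))) :: rat)"
      unfolding count by simp
    (* Multiplication by fps_X ^ n replaces r by r - n; for r < n both sides are 0. *)
    moreover have "fps_nth (fps_X ^ n * ?f) r = of_nat ((r + n - 1) choose (2 * n - 1))"
      using \<open>n > 0\<close> by (auto simp: fps_X_power_mult_nth binomial_eq_0 intro!: arg_cong2[of _ _ _ _ binomial])
    ultimately show "fps_nth ((1 - fps_X ^ n) * ?f) r = fps_nth (Abs_fps (\<lambda>r. of_nat (H_dihedral n r))) r"
      by (simp add: left_diff_distrib)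
  qed
  finally show "Abs_fps (\<lambda>r. of_nat (H_dihedral n r) :: rat)
      = (1 - fps_X ^ n) / (1 - fps_X) ^ (2 * n)"
    by (rule sym)
qed

end
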